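(* Let $G=(A\cup B,E)$ with $|A|=|B|=n$, where each agent has a strict partial order over her neighbors. If Algorithm 1 (described in the context), run on $G$, returns a matching $M$, then $M$ is a popular assignment in $G$.
   Context: For a level function $\ell:B\to\mathbb{N}$ and $a\in A$, let $\ell^*(a)=\max_{b\in\mathsf{Nbr}(a)}\ell(b)$, where $\mathsf{Nbr}(a)$ is the set of neighbors of $a$. The graph $G_\ell=(A\cup B,E_\ell)$ contains $(a,b)\in E$ iff (i) $\ell(b)=\ell^*(a)$ and $a$ has no neighbor $b'$ with $\ell(b')=\ell^*(a)$ and $b'\succ_a b$; or (ii) $\ell(b)=\ell^*(a)-1$, $b\succ_a b'$ for every neighbor $b'$ of $a$ with $\ell(b')=\ell^*(a)$, and $a$ has no neighbor $b''$ with $\ell(b'')=\ell^*(a)-1$ and $b''\succ_a b$. Algorithm 1: set $\ell(b)=0$ for all $b\in B$; while $\ell(b)<n$ for all $b\in B$: construct $G_\ell$ and compute a maximum matching $M$ in $G_\ell$; if $M$ is perfect, return $M$; otherwise increase $\ell(b)$ by 1 for every $b\in B$ unmatched in $M$. If the loop ends, report that $G$ has no popular assignment. For matchings $M,N$, agent $a$ prefers $M$ to $N$ if $a$ is matched in $M$ and either unmatched in $N$ or $M(a)\succ_a N(a)$; $\Delta(M,N)$ is the number of agents preferring $M$ to $N$ minus the number preferring $N$ to $M$. A popular assignment is a perfect matching $M$ with $\Delta(M,N)\ge0$ for all perfect matchings $N$. *)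

theory Defs
  imports Main
begin

text \<open>
  A bipartite graph with agents \<open>A\<close> and objects \<open>B\<close> is given by its edge set
  \<open>E \<subseteq> A \<times> B\<close>; the two sides live in different types and are therefore disjoint.
  Preferences are given by \<open>pref\<close>, where \<open>pref a b b'\<close> means that agent \<open>a\<close>
  prefers \<open>b\<close> to \<open>b'\<close>. Only the values of \<open>pref a\<close> on neighbours of \<open>a\<close> matter.
\<close>

definition Nbr :: "('a \<times> 'b) set \<Rightarrow> 'a \<Rightarrow> 'b set" where
  "Nbr E a = {b. (a, b) \<in> E}"

definition strict_partial_order_on :: "'b set \<Rightarrow> ('b \<Rightarrow> 'b \<Rightarrow> bool) \<Rightarrow> bool" where
  "strict_partial_order_on S R \<longleftrightarrow> irreflp_on S R \<and> transp_on S R"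

definition is_matching :: "('a \<times> 'b) set \<Rightarrow> ('a \<times> 'b) set \<Rightarrow> bool" where
  "is_matching E M \<longleftrightarrow> M \<subseteq> E \<and>
     (\<forall>a b a' b'. (a, b) \<in> M \<longrightarrow> (a', b') \<in> M \<longrightarrow> (a = a' \<longleftrightarrow> b = b'))"

definition agent_matched :: "('a \<times> 'b) set \<Rightarrow> 'a \<Rightarrow> bool" where
  "agent_matched M a \<longleftrightarrow> (\<exists>b. (a, b) \<in> M)"

definition object_matched :: "('a \<times> 'b) set \<Rightarrow> 'b \<Rightarrow> bool" where
  "object_matched M b \<longleftrightarrow> (\<exists>a. (a, b) \<in> M)"

definition maximum_matching :: "('a \<times> 'b) set \<Rightarrow> ('a \<times> 'b) set \<Rightarrow> bool" where
  "maximum_matching E M \<longleftrightarrow> is_matching E M \<and> (\<forall>N. is_matching E N \<longrightarrow> card N \<le> card M)"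

definition perfect_matching ::
    "'a set \<Rightarrow> 'b set \<Rightarrow> ('a \<times> 'b) set \<Rightarrow> ('a \<times> 'b) set \<Rightarrow> bool" where
  "perfect_matching A B E M \<longleftrightarrow> is_matching E M \<and>
     (\<forall>a\<in>A. agent_matched M a) \<and> (\<forall>b\<in>B. object_matched M b)"

text \<open>Meaningful only if \<open>a\<close> is matched in the matching \<open>M\<close>.\<close>

definition partner :: "('a \<times> 'b) set \<Rightarrow> 'a \<Rightarrow> 'b" where
  "partner M a = (THE b. (a, b) \<in> M)"

definition prefers_matching ::
    "('a \<Rightarrow> 'b \<Rightarrow> 'b \<Rightarrow> bool) \<Rightarrow> 'a \<Rightarrow> ('a \<times> 'b) set \<Rightarrow> ('a \<times> 'b) set \<Rightarrow> bool" where
  "prefers_matching pref a M N \<longleftrightarrow> agent_matched M a \<and>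
     (\<not> agent_matched N a \<or> pref a (partner M a) (partner N a))"

definition Delta ::
    "'a set \<Rightarrow> ('a \<Rightarrow> 'b \<Rightarrow> 'b \<Rightarrow> bool) \<Rightarrow> ('a \<times> 'b) set \<Rightarrow> ('a \<times> 'b) set \<Rightarrow> int" where
  "Delta A pref M N =
     int (card {a \<in> A. prefers_matching pref a M N})
     - int (card {a \<in> A. prefers_matching pref a N M})"

definition popular_assignment ::
    "'a set \<Rightarrow> 'b set \<Rightarrow> ('a \<times> 'b) set \<Rightarrow> ('a \<Rightarrow> 'b \<Rightarrow> 'b \<Rightarrow> bool) \<Rightarrow> ('a \<times> 'b) set \<Rightarrow> bool" where
  "popular_assignment A B E pref M \<longleftrightarrow> perfect_matching A B E M \<and>
     (\<forall>N. perfect_matching A B E N \<longrightarrow> Delta A pref M N \<ge> 0)"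

text \<open>If \<open>a\<close> has no neighbours, the value below is unspecified; it is then never used,
  since no edge is incident to \<open>a\<close>.\<close>

definition level_star :: "('a \<times> 'b) set \<Rightarrow> ('b \<Rightarrow> nat) \<Rightarrow> 'a \<Rightarrow> nat" where
  "level_star E l a = Max (l ` Nbr E a)"

text \<open>The condition \<open>l b = level_star E l a - 1\<close> is written as
  \<open>l b + 1 = level_star E l a\<close> to avoid truncated subtraction.\<close>

definition level_graph ::
    "('a \<times> 'b) set \<Rightarrow> ('a \<Rightarrow> 'b \<Rightarrow> 'b \<Rightarrow> bool) \<Rightarrow> ('b \<Rightarrow> nat) \<Rightarrow> ('a \<times> 'b) set" where
  "level_graph E pref l = {(a, b) \<in> E.
     (l b = level_star E l a \<and>
        \<not> (\<exists>b'\<in>Nbr E a. l b' = level_star E l a \<and> pref a b' b))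
   \<or> (l b + 1 = level_star E l a \<and>
        (\<forall>b'\<in>Nbr E a. l b' = level_star E l a \<longrightarrow> pref a b b') \<and>
        \<not> (\<exists>b''\<in>Nbr E a. l b'' + 1 = level_star E l a \<and> pref a b'' b))}"

text \<open>
  Big-step semantics of the while loop, started with level function \<open>l\<close>. It is a relation
  because the choice of the maximum matching is not specified. The outcome \<open>None\<close> is the
  report that there is no popular assignment.
\<close>

inductive popular_loop ::
    "'a set \<Rightarrow> 'b set \<Rightarrow> ('a \<times> 'b) set \<Rightarrow> ('a \<Rightarrow> 'b \<Rightarrow> 'b \<Rightarrow> bool) \<Rightarrow> nat
      \<Rightarrow> ('b \<Rightarrow> nat) \<Rightarrow> ('a \<times> 'b) set option \<Rightarrow> bool"
  for A B E pref n where
  report_none: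
    "\<not> (\<forall>b\<in>B. l b < n) \<Longrightarrow> popular_loop A B E pref n l None"
| return_matching:
    "\<lbrakk>\<forall>b\<in>B. l b < n; maximum_matching (level_graph E pref l) M;
      perfect_matching A B (level_graph E pref l) M\<rbrakk>
     \<Longrightarrow> popular_loop A B E pref n l (Some M)"
| raise_levels:
    "\<lbrakk>\<forall>b\<in>B. l b < n; maximum_matching (level_graph E pref l) M;
      \<not> perfect_matching A B (level_graph E pref l) M;
      popular_loop A B E pref n
        (\<lambda>b. if b \<in> B \<and> \<not> object_matched M b then l b + 1 else l b) r\<rbrakk>
     \<Longrightarrow> popular_loop A B E pref n l r"

definition popular_algorithm ::
    "'a set \<Rightarrow> 'b set \<Rightarrow> ('a \<times> 'b) set \<Rightarrow> ('a \<Rightarrow> 'b \<Rightarrow> 'b \<Rightarrow> bool) \<Rightarrow> nat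
      \<Rightarrow> ('a \<times> 'b) set option \<Rightarrow> bool" where
  "popular_algorithm A B E pref n r \<longleftrightarrow> popular_loop A B E pref n (\<lambda>_. 0) r"

end

theory Submission
  imports Defs
begin

text \<open>
  The levels certify popularity, in the manner of a dual solution. If \<open>(a, b)\<close> is an edge of
  the level graph and \<open>(a, c)\<close> any edge, then the vote of \<open>a\<close> for \<open>c\<close> against \<open>b\<close> is at most
  \<open>l b - l c\<close>. Summed over all agents, these bounds cancel, because two perfect matchings
  use the same objects.
\<close>

lemma partner_eq:
  assumes "is_matching E M" "(a, b) \<in> M"
  shows "partner M a = b"
  using assms unfolding partner_def is_matching_def by (intro the_equality) blast+

lemma partner_in_matching:
  assumes "is_matching E M" "agent_matched M a"
  shows "(a, partner M a) \<in> M"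
  using assms partner_eq unfolding agent_matched_def by metis

lemma perfect_matching_partner_in:
  assumes "perfect_matching A B E M" "a \<in> A"
  shows "(a, partner M a) \<in> M"
  using assms partner_in_matching[of E M a] by (simp add: perfect_matching_def)

lemma perfect_matching_partner_edge:
  assumes "perfect_matching A B E M" "a \<in> A"
  shows "(a, partner M a) \<in> E"
  using perfect_matching_partner_in[OF assms] assms(1)
  by (auto simp: perfect_matching_def is_matching_def)

text \<open>This turns a sum over agents of the levels of their partners into the sum of levels over
  \<open>B\<close>, which is the same for every perfect matching.\<close>

lemma bij_betw_partner:
  assumes "perfect_matching A B E M" "E \<subseteq> A \<times> B"
  shows "bij_betw (partner M) A B"
proof -
  have M: "is_matching E M"
    using assms(1) by (simp add: perfect_matching_def)
  note A = perfect_matching_partner_in[OF assms(1)]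
  have "a = a'" if "a \<in> A" "a' \<in> A" "partner M a = partner M a'" for a a'
    using A[OF that(1)] A[OF that(2)] M that(3) by (simp add: is_matching_def)
  then have "inj_on (partner M) A"
    by (rule inj_onI)
  moreover have "partner M a \<in> B" if "a \<in> A" for a
    using perfect_matching_partner_edge[OF assms(1) that] assms(2) by auto
  moreover have "b \<in> partner M ` A" if b: "b \<in> B" for b
  proof -
    obtain a where a: "(a, b) \<in> M"
      using assms(1) b by (auto simp: perfect_matching_def object_matched_def)
    then have "a \<in> A"
      using M assms(2) by (auto simp: is_matching_def)
    then show ?thesis
      using partner_eq[OF M a] by blast
  qed
  ultimately show ?thesis
    by (auto simp: bij_betw_def)
qed

lemma level_graph_subset: "level_graph E pref l \<subseteq> E"
  by (auto simp: level_graph_def)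

lemma perfect_matching_mono:
  assumes "perfect_matching A B E M" "E \<subseteq> E'"
  shows "perfect_matching A B E' M"
  using assms by (auto simp: perfect_matching_def is_matching_def)

text \<open>A vote is at most 1, so the bound is automatic if \<open>l b > l c\<close>. Otherwise
  either \<open>b\<close> and \<open>c\<close> share a level, where no neighbour beats
  \<open>b\<close>, or \<open>c\<close> is one level above \<open>b\<close>, and then
  \<open>b\<close> is preferred to every neighbour on that upper level.\<close>

lemma level_graph_vote_le:
  assumes "finite (Nbr E a)" "strict_partial_order_on (Nbr E a) (pref a)"
    and b: "(a, b) \<in> level_graph E pref l" and c: "(a, c) \<in> E"
  shows "of_bool (pref a c b) - of_bool (pref a b c) \<le> int (l b) - int (l c)"
proof -
  have bN: "b \<in> Nbr E a" and cN: "c \<in> Nbr E a"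
    using b c by (auto simp: level_graph_def Nbr_def)
  \<comment> \<open>If \<open>c\<close> is one level above \<open>b\<close>, the vote must be
    exactly -1, so \<open>pref a b c\<close> has to exclude \<open>pref a c b\<close>. Both together
    would give \<open>pref a b b\<close> by transitivity.\<close>
  have asym: "\<not> (pref a c b \<and> pref a b c)"
    using assms(2) bN cN transp_onD[of "Nbr E a" "pref a" b c b] irreflp_onD[of "Nbr E a" "pref a" b]
    unfolding strict_partial_order_on_def by blast
  have "l c \<le> level_star E l a"
    unfolding level_star_def using assms(1) cN by simp
  \<comment> \<open>As \<open>b\<close> is at most one below the top level, a \<open>c\<close> two
    or more below it leaves a bound of at least 1.\<close>
  then consider "l c = level_star E l a" | "l c + 1 = level_star E l a" | "l c + 1 < level_star E l a"
    by linarith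
  then show ?thesis
    using b asym cN by cases (auto simp: level_graph_def of_bool_def)
qed

text \<open>The witness is the level function in force when the loop returns. The outcome stays a
  variable tied by an equation so that rule induction applies.\<close>

lemma popular_loop_SomeD:
  assumes "popular_loop A B E pref n l r" "r = Some M"
  shows "\<exists>l'. perfect_matching A B (level_graph E pref l') M"
  using assms by induction auto

text \<open>All agents of \<open>A\<close> are matched on both sides, so preferring a matching
  reduces to preferring the partner in it.\<close>

lemma Delta_eq_sum_votes:
  assumes "finite A" "perfect_matching A B E M" "perfect_matching A B E N"
  shows "Delta A pref M N =
    (\<Sum>a\<in>A. of_bool (pref a (partner M a) (partner N a))
      - of_bool (pref a (partner N a) (partner M a)))"
proof -
  have "{a \<in> A. prefers_matching pref a M N} = A \<inter> {a. pref a (partner M a) (partner N a)}"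
    "{a \<in> A. prefers_matching pref a N M} = A \<inter> {a. pref a (partner N a) (partner M a)}"
    using assms(2,3) unfolding prefers_matching_def perfect_matching_def by blast+
  then show ?thesis
    using assms(1) by (simp add: Delta_def sum_subtractf sum_of_bool_eq)
qed

text \<open>The certificate depends only on the final levels, so \<open>l\<close> is arbitrary and
  no loop invariant enters.\<close>

lemma perfect_matching_level_graph_popular:
  assumes "finite A" "finite B" and E: "E \<subseteq> A \<times> B"
    and pref: "\<And>a. a \<in> A \<Longrightarrow> strict_partial_order_on (Nbr E a) (pref a)"
    and M: "perfect_matching A B (level_graph E pref l) M"
  shows "popular_assignment A B E pref M"
  unfolding popular_assignment_def
proof (intro conjI allI impI)
  show ME: "perfect_matching A B E M"
    using M level_graph_subset by (rule perfect_matching_mono)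
  fix N assume N: "perfect_matching A B E N"
  \<comment> \<open>Both parts reindex to the total level of \<open>B\<close>.\<close>
  have "(\<Sum>a\<in>A. int (l (partner N a)) - int (l (partner M a))) = 0"
    using sum.reindex_bij_betw[OF bij_betw_partner[OF ME E], of "\<lambda>b. int (l b)"]
      sum.reindex_bij_betw[OF bij_betw_partner[OF N E], of "\<lambda>b. int (l b)"]
    by (simp add: sum_subtractf)
  \<comment> \<open>This is the vote bound with both sides negated: it limits the vote for
    \<open>N\<close> against \<open>M\<close> from above, hence the vote for \<open>M\<close> from
    below.\<close>
  moreover have "int (l (partner N a)) - int (l (partner M a))
      \<le> of_bool (pref a (partner M a) (partner N a)) - of_bool (pref a (partner N a) (partner M a))"
    if "a \<in> A" for a
  proof -
    have "Nbr E a \<subseteq> B"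
      using E by (auto simp: Nbr_def)
    then have "finite (Nbr E a)"
      using assms(2) by (rule finite_subset)
    moreover have "(a, partner M a) \<in> level_graph E pref l" "(a, partner N a) \<in> E"
      using perfect_matching_partner_edge[OF M that] perfect_matching_partner_edge[OF N that] .
    ultimately show ?thesis
      using level_graph_vote_le[of E a pref "partner M a" l "partner N a"] pref[OF that] by linarith
  qed
  then have "(\<Sum>a\<in>A. int (l (partner N a)) - int (l (partner M a))) \<le> Delta A pref M N"
    unfolding Delta_eq_sum_votes[OF assms(1) ME N] by (rule sum_mono)
  ultimately show "Delta A pref M N \<ge> 0"
    by linarith
qed

theorem theorem8:
  fixes A :: "'a set" and B :: "'b set" and E :: "('a \<times> 'b) set"
    and pref :: "'a \<Rightarrow> 'b \<Rightarrow> 'b \<Rightarrow> bool" and n :: nat and M :: "('a \<times> 'b) set"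
  assumes "finite A" and "finite B" and "card A = n" and "card B = n"
    and "E \<subseteq> A \<times> B"
    and "\<And>a. a \<in> A \<Longrightarrow> strict_partial_order_on (Nbr E a) (pref a)"
    and "popular_algorithm A B E pref n (Some M)"
  shows "popular_assignment A B E pref M"
proof -
  obtain l where "perfect_matching A B (level_graph E pref l) M"
    using popular_loop_SomeD[OF assms(7)[unfolded popular_algorithm_def] refl] by blast
  then show ?thesis
    using perfect_matching_level_graph_popular[OF assms(1,2,5,6)] by blast
qed

end
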